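(* Let $\mathfrak h$ be a finite-dimensional real (left) Leibniz algebra with left center $Z_L(\mathfrak h)$, let $\pi:\mathfrak h\to\mathfrak h_{\rm Lie}=\mathfrak h/Z_L(\mathfrak h)$ be the projection, let $s:\mathfrak h_{\rm Lie}\to\mathfrak h$ be a linear section of $\pi$, let $\omega(X,Y)=[s(X),s(Y)]-s([X,Y])$ be the associated Leibniz $2$-cocycle, and let $$f(X,Y)=\exp(\mathrm{ad}_{s(X)})(s(Y))-s\big(\exp(\mathrm{ad}_X)(Y)\big),\qquad X,Y\in\mathfrak h_{\rm Lie},$$ be the associated rack $2$-cocycle. Then for all $X,Y\in\mathfrak h_{\rm Lie}$, $$f(X,Y)=\sum_{j\ge 0}\ \sum_{m\ge 0}\frac{1}{(j+m+1)!}\,(\mathrm{ad}_{s(X)})^{j}\,\omega\big(X,(\mathrm{ad}_X)^m(Y)\big),$$ that is, $$\begin{aligned} f(X,Y)&=\omega(X,Y)+\tfrac12\omega(X,[X,Y])+\tfrac16\omega(X,[X,[X,Y]])+\ldots\\ &\quad+\tfrac12[s(X),\omega(X,Y)]+\tfrac16[s(X),\omega(X,[X,Y])]+\ldots\\ &\quad+\tfrac16[s(X),[s(X),\omega(X,Y)]]+\ldots\\ &\quad+\ldots\end{aligned}$$ where the terms are grouped according to the number of $s(X)$ acting upon terms in $\omega$.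
   Context: A (left) Leibniz algebra is a vector space $\mathfrak h$ with a bilinear bracket satisfying $[X,[Y,Z]]=[[X,Y],Z]+[Y,[X,Z]]$; $\mathrm{ad}_X(Y)=[X,Y]$. The left center is $Z_L(\mathfrak h)=\{X\in\mathfrak h\mid [X,Y]=0\ \forall\,Y\in\mathfrak h\}$; it is an ideal and $\mathfrak h_{\rm Lie}:=\mathfrak h/Z_L(\mathfrak h)$ is a Lie algebra. Both $\omega$ and $f$ take values in $Z_L(\mathfrak h)=\ker\pi$. The map $f$ is the cocycle of the abelian extension of racks $R_{\mathfrak h}\to \{(X,\exp\mathrm{ad}_X): X\in\mathfrak h_{\rm Lie}\}$, $(X,\exp\mathrm{ad}_X)\mapsto(\pi(X),\exp\mathrm{ad}_{\pi(X)})$, where $R_{\mathfrak h}=\{(X,\exp\mathrm{ad}_X):X\in\mathfrak h\}$ has rack product $(X,\alpha)\rhd(Y,\beta)=(\alpha(Y),\alpha\beta\alpha^{-1})$, computed with respect to the section $(X,\exp\mathrm{ad}_X)\mapsto(s(X),\exp\mathrm{ad}_{s(X)})$; only its $Z_L(\mathfrak h)$-component is displayed. *)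

theory Defs
  imports "HOL-Analysis.Analysis"
begin

class leibniz_algebra = real_vector +
  fixes bracket :: "'a \<Rightarrow> 'a \<Rightarrow> 'a"
  assumes bracket_add_left: "bracket (x + y) z = bracket x z + bracket y z"
    and bracket_add_right: "bracket x (y + z) = bracket x y + bracket x z"
    and bracket_scaleR_left: "bracket (c *\<^sub>R x) y = c *\<^sub>R bracket x y"
    and bracket_scaleR_right: "bracket x (c *\<^sub>R y) = c *\<^sub>R bracket x y"
    and leibniz: "bracket x (bracket y z) = bracket (bracket x y) z + bracket y (bracket x z)"

text \<open>
  The norm only provides the topology needed for the exponential series: a finite-dimensional
  real vector space carries a norm, and all its norms induce the same topology.  Unlike
  the class \<^class>\<open>euclidean_space\<close>, this class admits the zero algebra.
\<close>

class fd_leibniz_algebra = leibniz_algebra + real_normed_vector +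
  assumes finite_dim: "\<exists>B. finite B \<and> (\<forall>x. \<exists>c. x = (\<Sum>b\<in>B. c b *\<^sub>R b))"

definition ad :: "'a::leibniz_algebra \<Rightarrow> 'a \<Rightarrow> 'a"
  where "ad x y = bracket x y"

definition left_center :: "'a::leibniz_algebra set"
  where "left_center = {x. \<forall>y. bracket x y = 0}"

lemma subspace_left_center: "subspace (left_center :: 'a::leibniz_algebra set)"
proof -
  have "bracket (0 :: 'a) y = 0" for y
    using bracket_scaleR_left[of 0 0 y] by simp
  then show ?thesis
    by (simp add: subspace_def left_center_def bracket_add_left bracket_scaleR_left)
qed

lemma bracket_left_center:
  assumes "z \<in> left_center"
  shows "bracket x z \<in> left_center"
proof -
  have x0: "bracket x 0 = 0"
    using bracket_scaleR_right[of x 0 0] by simp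
  have z: "bracket z y = 0" for y
    using assms by (simp add: left_center_def)
  have "bracket (bracket x z) y = 0" for y
    using leibniz[of x z y] by (simp only: z x0 add_0_right)
  then show ?thesis
    by (simp add: left_center_def)
qed

lemma bracket_diff_left: "bracket (x - y) z = bracket x z - bracket y z"
  using bracket_add_left[of "x - y" y z] by simp

lemma bracket_diff_right: "bracket x (y - z) = bracket x y - bracket x z"
  using bracket_add_right[of x "y - z" z] by simp

quotient_type (overloaded) 'a h_Lie = "'a::leibniz_algebra" /
    "\<lambda>x y. x - y \<in> left_center"
proof (rule equivpI)
  show "reflp (\<lambda>x y :: 'a. x - y \<in> left_center)"
    by (simp add: reflp_def subspace_0 subspace_left_center)
  show "symp (\<lambda>x y :: 'a. x - y \<in> left_center)"
    using subspace_neg[OF subspace_left_center] by (fastforce simp: symp_def)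
  show "transp (\<lambda>x y :: 'a. x - y \<in> left_center)"
  proof (rule transpI)
    fix x y z :: 'a
    assume "x - y \<in> left_center" "y - z \<in> left_center"
    from subspace_add[OF subspace_left_center this] show "x - z \<in> left_center"
      by simp
  qed
qed

lift_definition proj :: "'a::leibniz_algebra \<Rightarrow> 'a h_Lie" is "\<lambda>x. x" .

instantiation h_Lie :: (leibniz_algebra) leibniz_algebra
begin

lift_definition zero_h_Lie :: "'a h_Lie" is 0 .

lift_definition plus_h_Lie :: "'a h_Lie \<Rightarrow> 'a h_Lie \<Rightarrow> 'a h_Lie" is "(+)"
proof -
  fix x x' y y' :: 'a
  assume "x - x' \<in> left_center" "y - y' \<in> left_center"
  from subspace_add[OF subspace_left_center this]
  show "x + y - (x' + y') \<in> left_center"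
    by (simp add: algebra_simps)
qed

lift_definition minus_h_Lie :: "'a h_Lie \<Rightarrow> 'a h_Lie \<Rightarrow> 'a h_Lie" is "(-)"
proof -
  fix x x' y y' :: 'a
  assume "x - x' \<in> left_center" "y - y' \<in> left_center"
  from subspace_diff[OF subspace_left_center this]
  show "x - y - (x' - y') \<in> left_center"
    by (simp add: algebra_simps)
qed

lift_definition uminus_h_Lie :: "'a h_Lie \<Rightarrow> 'a h_Lie" is uminus
proof -
  fix x x' :: 'a
  assume "x - x' \<in> left_center"
  from subspace_neg[OF subspace_left_center this]
  show "- x - - x' \<in> left_center"
    by simp
qed

lift_definition scaleR_h_Lie :: "real \<Rightarrow> 'a h_Lie \<Rightarrow> 'a h_Lie" is scaleR
proof -
  fix c :: real and x x' :: 'a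
  assume "x - x' \<in> left_center"
  from subspace_scale[OF subspace_left_center this]
  show "c *\<^sub>R x - c *\<^sub>R x' \<in> left_center"
    by (simp add: scaleR_right_diff_distrib)
qed

lift_definition bracket_h_Lie :: "'a h_Lie \<Rightarrow> 'a h_Lie \<Rightarrow> 'a h_Lie" is bracket
proof -
  fix x x' y y' :: 'a
  assume x: "x - x' \<in> left_center" and y: "y - y' \<in> left_center"
  have "bracket x y - bracket x' y' = bracket (x - x') y + bracket x' (y - y')"
    by (simp add: bracket_diff_left bracket_diff_right)
  also have "bracket (x - x') y = 0"
    using x by (simp add: left_center_def)
  finally show "bracket x y - bracket x' y' \<in> left_center"
    using bracket_left_center[OF y] by simp
qed

instance
proof
  have zero: "(0 :: 'a) \<in> left_center"
    by (rule subspace_0[OF subspace_left_center])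
  fix x y z :: "'a h_Lie" and a b :: real
  show "x + y + z = x + (y + z)" by transfer (simp add: zero add.assoc)
  show "x + y = y + x" by transfer (simp add: zero add.commute)
  show "0 + x = x" by transfer (simp add: zero)
  show "- x + x = 0" by transfer (simp add: zero)
  show "x - y = x + - y" by transfer (simp add: zero)
  show "a *\<^sub>R (x + y) = a *\<^sub>R x + a *\<^sub>R y" by transfer (simp add: zero scaleR_add_right)
  show "(a + b) *\<^sub>R x = a *\<^sub>R x + b *\<^sub>R x" by transfer (simp add: zero scaleR_add_left)
  show "a *\<^sub>R b *\<^sub>R x = (a * b) *\<^sub>R x" by transfer (simp add: zero)
  show "1 *\<^sub>R x = x" by transfer (simp add: zero)
  show "bracket (x + y) z = bracket x z + bracket y z"
    by transfer (simp add: zero bracket_add_left)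
  show "bracket x (y + z) = bracket x y + bracket x z"
    by transfer (simp add: zero bracket_add_right)
  show "bracket (a *\<^sub>R x) y = a *\<^sub>R bracket x y"
    by transfer (simp add: zero bracket_scaleR_left)
  show "bracket x (a *\<^sub>R y) = a *\<^sub>R bracket x y"
    by transfer (simp add: zero bracket_scaleR_right)
  show "bracket x (bracket y z) = bracket (bracket x y) z + bracket y (bracket x z)"
    by transfer (simp add: zero flip: leibniz)
qed

end

lemma h_Lie_is_Lie: "bracket X X = (0 :: 'a::leibniz_algebra h_Lie)"
proof transfer
  fix x :: 'a
  have "bracket (bracket x x) y = 0" for y
    using leibniz[of x x y] by (metis add_cancel_left_left)
  then show "bracket x x - 0 \<in> left_center"
    by (simp add: left_center_def)
qed

text \<open>
  The quotient topology; in finite dimension it is the usual topology of the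
  finite-dimensional vector space \<^typ>\<open>'a h_Lie\<close>.
\<close>

instantiation h_Lie :: (fd_leibniz_algebra) topological_space
begin

definition open_h_Lie :: "'a h_Lie set \<Rightarrow> bool"
  where "open_h_Lie U \<longleftrightarrow> open (proj -` U)"

instance
proof
  show "open (UNIV :: 'a h_Lie set)"
    by (simp add: open_h_Lie_def)
  show "open (S \<inter> T)" if "open S" "open T" for S T :: "'a h_Lie set"
    using open_Int that unfolding open_h_Lie_def vimage_Int by blast
  show "open (\<Union>K)" if "\<forall>S\<in>K. open S" for K :: "'a h_Lie set set"
    using open_UN[of K "\<lambda>S. proj -` S"] that unfolding open_h_Lie_def vimage_Union by blast
qed

end

text \<open>
  The series is taken pointwise, in the topology of the underlying space; in finite dimension
  this is the same as applying the exponential of the operator to the vector.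
\<close>

definition exp_op :: "('a \<Rightarrow> 'a) \<Rightarrow> 'a \<Rightarrow> 'a::{real_vector,topological_space}"
  where "exp_op T y = (\<Sum>n. (1 / fact n) *\<^sub>R (T ^^ n) y)"

definition omega :: "('a h_Lie \<Rightarrow> 'a) \<Rightarrow> 'a h_Lie \<Rightarrow> 'a h_Lie \<Rightarrow> 'a::leibniz_algebra"
  where "omega s X Y = bracket (s X) (s Y) - s (bracket X Y)"

definition rack_cocycle ::
    "('a h_Lie \<Rightarrow> 'a) \<Rightarrow> 'a h_Lie \<Rightarrow> 'a h_Lie \<Rightarrow> 'a::fd_leibniz_algebra"
  where "rack_cocycle s X Y = exp_op (ad (s X)) (s Y) - s (exp_op (ad X) Y)"

end

theory Submission
  imports Defs
begin

text \<open>
  Put \<open>A = ad (s X)\<close> and let \<open>B\<close> be the endomorphism of the algebra with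
  \<open>s (ad X Z) = B (s Z)\<close>. Then \<open>\<omega> (X, ad X ^ m (Y)) = (A - B) B ^ m (s Y)\<close>, so the terms
  with \<open>j + m = n\<close> telescope to \<open>(A ^ (n + 1) - B ^ (n + 1)) (s Y) / (n + 1)!\<close>, whose sum over
  \<open>n\<close> is \<open>exp A (s Y) - exp B (s Y) = f (X, Y)\<close>. The rearrangement is justified by absolute
  convergence. Since the norm of the algebra is an arbitrary one, boundedness of linear maps and
  convergence of series are first reduced to coordinates.
\<close>

section \<open>Coordinates in finite-dimensional normed spaces\<close>

text \<open>Compactness argument: on coefficient families of l1 norm 1 the norm of the combination
  attains a minimum, which independence makes positive. By homogeneity its inverse serves as
  \<open>C\<close>.\<close>

lemma independent_coefficients_bound:
  fixes B :: "'a::real_normed_vector set"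
  assumes "finite B" and "independent B"
  shows "\<exists>C\<ge>0. \<forall>c. (\<Sum>b\<in>B. \<bar>c b\<bar>) \<le> C * norm (\<Sum>b\<in>B. c b *\<^sub>R b)"
proof (cases "B = {}")
  case True
  then show ?thesis by auto
next
  case False
  \<comment> \<open>Coefficients are functions on the whole type, so values outside \<open>B\<close>
    are pinned to 0; \<open>K\<close> is then a product of compact sets, compact by
    Tychonoff.\<close>
  define K :: "('a \<Rightarrow> real) set" where "K = PiE UNIV (\<lambda>b. if b \<in> B then {-1..1} else {0})"
  define S where "S = K \<inter> {c. (\<Sum>b\<in>B. \<bar>c b\<bar>) = 1}"
  have "compact K"
    unfolding K_def compactin_euclidean_iff[symmetric] euclidean_product_topology[symmetric]
    by (simp add: compactin_PiE)
  moreover have "closed {c :: 'a \<Rightarrow> real. (\<Sum>b\<in>B. \<bar>c b\<bar>) = 1}"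
    by (intro closed_Collect_eq continuous_intros continuous_on_product_coordinates)
  ultimately have "compact S"
    unfolding S_def by (rule compact_Int_closed)
  moreover obtain b0 where "b0 \<in> B"
    using False by blast
  then have "(\<lambda>b. if b = b0 then 1 else 0) \<in> S"
    using assms(1) by (auto simp: S_def K_def if_distrib[of abs] cong: if_cong)
  then have "S \<noteq> {}" by blast
  moreover have "continuous_on S (\<lambda>c. norm (\<Sum>b\<in>B. c b *\<^sub>R b))"
    by (intro continuous_intros continuous_on_subset[OF continuous_on_product_coordinates]) auto
  ultimately obtain c0 where c0: "c0 \<in> S"
    and min: "\<And>c. c \<in> S \<Longrightarrow> norm (\<Sum>b\<in>B. c0 b *\<^sub>R b) \<le> norm (\<Sum>b\<in>B. c b *\<^sub>R b)"
    using continuous_attains_inf[of S "\<lambda>c. norm (\<Sum>b\<in>B. c b *\<^sub>R b)"] by auto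
  define \<mu> where "\<mu> = norm (\<Sum>b\<in>B. c0 b *\<^sub>R b)"
  have "\<mu> \<noteq> 0"
  proof
    assume "\<mu> = 0"
    then have "\<forall>b\<in>B. c0 b = 0"
      using assms by (auto simp: \<mu>_def independent_explicit_finite_subsets)
    then show False
      using c0 by (simp add: S_def)
  qed
  then have pos: "\<mu> > 0"
    by (simp add: \<mu>_def)
  have "(\<Sum>b\<in>B. \<bar>c b\<bar>) \<le> inverse \<mu> * norm (\<Sum>b\<in>B. c b *\<^sub>R b)" for c
  proof (cases "(\<Sum>b\<in>B. \<bar>c b\<bar>) = 0")
    case True
    then show ?thesis
      using pos by simp
  next
    case False
    define t where "t = (\<Sum>b\<in>B. \<bar>c b\<bar>)"
    have t: "t > 0"
      using False by (simp add: t_def sum_nonneg less_le)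
    define d where "d b = (if b \<in> B then c b / t else 0)" for b
    have "\<bar>c b\<bar> \<le> t" if "b \<in> B" for b
      unfolding t_def using that assms(1) by (intro member_le_sum) auto
    then have "\<bar>d b\<bar> \<le> 1" if "b \<in> B" for b
      using t that by (simp add: d_def)
    moreover have "d b = 0" if "b \<notin> B" for b
      using that by (simp add: d_def)
    ultimately have "d \<in> K"
      by (auto simp: K_def abs_le_iff minus_le_iff)
    moreover have "(\<Sum>b\<in>B. \<bar>d b\<bar>) = 1"
      using t by (simp add: d_def t_def flip: sum_divide_distrib)
    ultimately have "\<mu> \<le> norm (\<Sum>b\<in>B. d b *\<^sub>R b)"
      unfolding \<mu>_def by (intro min) (simp add: S_def)
    also have "(\<Sum>b\<in>B. d b *\<^sub>R b) = inverse t *\<^sub>R (\<Sum>b\<in>B. c b *\<^sub>R b)"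
      by (simp add: d_def scaleR_sum_right divide_inverse mult.commute)
    finally show ?thesis
      using t pos by (simp add: t_def[symmetric] field_simps)
  qed
  then show ?thesis
    using pos by (intro exI[of _ "inverse \<mu>"]) simp
qed

text \<open>For a basis taken from \<open>S\<close>, one coordinate is at most the l1 norm of all of
  them, hence at most \<open>C\<close> times the norm. Continuity and convergence can thus be tested
  on real coordinates.\<close>

lemma obtain_bounded_coordinates:
  fixes S :: "'a::real_normed_vector set"
  assumes "finite S" and "span S = UNIV"
  obtains B and \<phi> :: "'a \<Rightarrow> 'a \<Rightarrow> real"
  where "finite B" and "\<And>b. b \<in> B \<Longrightarrow> bounded_linear (\<phi> b)"
    and "\<And>x. x = (\<Sum>b\<in>B. \<phi> b x *\<^sub>R b)"
proof -
  obtain B where B: "B \<subseteq> S" "independent B" "span B = UNIV"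
    using assms(2) by (metis basis_exists span_mono span_span subset_antisym top_greatest)
  have fin: "finite B"
    using B(1) assms(1) by (rule finite_subset)
  define \<phi> where "\<phi> b x = representation B x b" for b x
  have repr: "x = (\<Sum>b\<in>B. \<phi> b x *\<^sub>R b)" for x
    using B fin by (simp add: \<phi>_def sum_representation_eq)
  obtain C where C: "\<And>c. (\<Sum>b\<in>B. \<bar>c b\<bar>) \<le> C * norm (\<Sum>b\<in>B. c b *\<^sub>R b)"
    using independent_coefficients_bound[OF fin B(2)] by blast
  have "bounded_linear (\<phi> b)" if "b \<in> B" for b
  proof (rule bounded_linear_intro[where K = C])
    fix x y :: 'a and r :: real
    show "\<phi> b (x + y) = \<phi> b x + \<phi> b y" "\<phi> b (r *\<^sub>R x) = r *\<^sub>R \<phi> b x"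
      using B by (simp_all add: \<phi>_def representation_add representation_scale)
    have "\<bar>\<phi> b x\<bar> \<le> (\<Sum>b\<in>B. \<bar>\<phi> b x\<bar>)"
      using that fin by (intro member_le_sum) auto
    also have "\<dots> \<le> C * norm x"
      using C[of "\<lambda>b. \<phi> b x"] repr[of x] by simp
    finally show "norm (\<phi> b x) \<le> norm x * C"
      by (simp add: mult.commute)
  qed
  then show ?thesis
    using that fin repr by blast
qed

text \<open>In coordinates, \<open>f\<close> is a finite sum of bounded functionals times the fixed
  vectors \<open>f b\<close>.\<close>

lemma finite_span_linear_imp_bounded_linear:
  fixes f :: "'a::real_normed_vector \<Rightarrow> 'b::real_normed_vector"
  assumes "finite S" and "span S = (UNIV :: 'a set)" and "linear f"
  shows "bounded_linear f"
proof -
  obtain B and \<phi> :: "'a \<Rightarrow> 'a \<Rightarrow> real" where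
    \<phi>: "\<And>b. b \<in> B \<Longrightarrow> bounded_linear (\<phi> b)" and repr: "\<And>x. x = (\<Sum>b\<in>B. \<phi> b x *\<^sub>R b)"
    using obtain_bounded_coordinates[OF assms(1,2)] by metis
  have "f x = (\<Sum>b\<in>B. \<phi> b x *\<^sub>R f b)" for x
    by (subst repr[of x]) (simp add: linear_sum[OF assms(3)] linear_scale[OF assms(3)])
  then have "f = (\<lambda>x. \<Sum>b\<in>B. \<phi> b x *\<^sub>R f b)"
    by blast
  moreover have "bounded_linear (\<lambda>x. \<Sum>b\<in>B. \<phi> b x *\<^sub>R f b)"
    by (intro bounded_linear_sum bounded_linear_scaleR_const \<phi>)
  ultimately show ?thesis
    by simp
qed

text \<open>The class does not assume completeness, so the comparison test is run on each real
  coordinate and the finitely many coordinate series are recombined.\<close>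

lemma finite_span_summable_comparison:
  fixes f :: "nat \<Rightarrow> 'a::real_normed_vector"
  assumes "finite S" and "span S = (UNIV :: 'a set)"
    and "summable g" and "\<And>n. norm (f n) \<le> g n"
  shows "summable f"
proof -
  obtain B and \<phi> :: "'a \<Rightarrow> 'a \<Rightarrow> real" where
    \<phi>: "\<And>b. b \<in> B \<Longrightarrow> bounded_linear (\<phi> b)" and repr: "\<And>x. x = (\<Sum>b\<in>B. \<phi> b x *\<^sub>R b)"
    using obtain_bounded_coordinates[OF assms(1,2)] by metis
  have "summable (\<lambda>n. \<phi> b (f n))" if b: "b \<in> B" for b
  proof -
    obtain K where K: "\<And>x. norm (\<phi> b x) \<le> norm x * K" "K \<ge> 0"
      using bounded_linear.nonneg_bounded[OF \<phi>[OF b]] by blast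
    have "norm (\<phi> b (f n)) \<le> g n * K" for n
      using K(1)[of "f n"] mult_right_mono[OF assms(4)[of n] K(2)] by linarith
    then show ?thesis
      by (intro summable_comparison_test'[OF summable_mult2[OF assms(3), of K]])
  qed
  then have "summable (\<lambda>n. \<Sum>b\<in>B. \<phi> b (f n) *\<^sub>R b)"
    by (intro summable_sum bounded_linear.summable[OF bounded_linear_scaleR_left])
  then show ?thesis
    unfolding repr[symmetric] .
qed

section \<open>Rearrangement of double series\<close>

text \<open>Fubini in two directions: absolute summability over all pairs gives row sums and
  diagonal sums the same total \<open>T\<close>, which the known diagonal limit identifies as
  \<open>S\<close>.\<close>

lemma abs_summable_diagonal_sums:
  fixes a :: "nat \<Rightarrow> nat \<Rightarrow> 'a::banach"
  assumes abs: "(\<lambda>(j, m). norm (a j m)) summable_on UNIV"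
    and diag: "(\<lambda>n. \<Sum>j\<le>n. a j (n - j)) sums S"
  shows "summable (a j)" and "(\<lambda>j. \<Sum>m. a j m) sums S"
proof -
  have abs': "(\<lambda>p. norm (case p of (j, m) \<Rightarrow> a j m)) summable_on UNIV \<times> UNIV"
    using abs by (simp add: case_prod_unfold)
  then have summ: "(\<lambda>(j, m). a j m) summable_on UNIV \<times> UNIV"
    by (rule abs_summable_summable)
  have "(\<lambda>m. norm (a j m)) summable_on UNIV" for j
    using abs' unfolding Infinite_Sum.abs_summable_on_Sigma_iff by simp
  then have row: "a j summable_on UNIV" for j
    by (rule abs_summable_summable)
  then show "summable (a j)" for j
    by (rule summable_on_imp_summable)
  obtain T where T: "((\<lambda>(j, m). a j m) has_sum T) (UNIV \<times> UNIV)"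
    using summ by (auto simp: summable_on_def)
  have "(a j has_sum (\<Sum>m. a j m)) UNIV" for j
    using has_sum_imp_sums[OF has_sum_infsum[OF row[of j]]] has_sum_infsum[OF row[of j]]
    by (simp add: sums_iff)
  then have "((\<lambda>j. \<Sum>m. a j m) has_sum T) UNIV"
    by (intro has_sum_SigmaD[OF T]) auto
  then have rows: "(\<lambda>j. \<Sum>m. a j m) sums T"
    by (rule has_sum_imp_sums)
  \<comment> \<open>The pair \<open>(j, m)\<close> goes to \<open>(j + m, j)\<close>, so each
    diagonal becomes a finite row of the triangle \<open>j \<le> n\<close>.\<close>
  have "((\<lambda>(j, m). a j m) has_sum T) (UNIV \<times> UNIV)
      = ((\<lambda>(n, j). a j (n - j)) has_sum T) (Sigma UNIV (\<lambda>n. {..n}))"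
    by (rule has_sum_reindex_bij_witness[of _ "\<lambda>(n, j). (j, n - j)" "\<lambda>(j, m). (j + m, j)"]) auto
  with T have "((\<lambda>(n, j). a j (n - j)) has_sum T) (Sigma UNIV (\<lambda>n. {..n}))"
    by simp
  then have "((\<lambda>n. \<Sum>j\<le>n. a j (n - j)) has_sum T) UNIV"
    by (rule has_sum_SigmaD) (auto intro: has_sum_finiteI)
  then have "(\<lambda>n. \<Sum>j\<le>n. a j (n - j)) sums T"
    by (rule has_sum_imp_sums)
  with diag have "T = S"
    using sums_unique2 by blast
  with rows show "(\<lambda>j. \<Sum>m. a j m) sums S"
    by simp
qed

text \<open>The product bound makes every real coordinate of the double series absolutely summable.
  The rearrangement takes place there, and the coordinates are reassembled.\<close>

lemma finite_span_diagonal_sums: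
  fixes a :: "nat \<Rightarrow> nat \<Rightarrow> 'a::real_normed_vector"
  assumes S: "finite S" "span S = (UNIV :: 'a set)"
    and g: "summable g" "\<And>j. g j \<ge> 0" and h: "summable h" "\<And>m. h m \<ge> 0"
    and bound: "\<And>j m. norm (a j m) \<le> g j * h m"
    and diag: "(\<lambda>n. \<Sum>j\<le>n. a j (n - j)) sums L"
  shows "summable (a j)" and "(\<lambda>j. \<Sum>m. a j m) sums L"
proof -
  obtain B and \<phi> :: "'a \<Rightarrow> 'a \<Rightarrow> real" where
    \<phi>: "\<And>b. b \<in> B \<Longrightarrow> bounded_linear (\<phi> b)" and repr: "\<And>x. x = (\<Sum>b\<in>B. \<phi> b x *\<^sub>R b)"
    using obtain_bounded_coordinates[OF S] by metis
  show summ: "summable (a j)" for j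
    using summable_mult[OF h(1)] bound by (rule finite_span_summable_comparison[OF S])
  have "(\<lambda>j. \<phi> b (\<Sum>m. a j m)) sums \<phi> b L" if b: "b \<in> B" for b
  proof -
    interpret bounded_linear "\<phi> b"
      using \<phi>[OF b] .
    obtain K where K: "\<And>x. norm (\<phi> b x) \<le> norm x * K" "K \<ge> 0"
      using nonneg_bounded by blast
    have "g summable_on UNIV" "h summable_on UNIV"
      using g h by (simp_all add: summable_nonneg_imp_summable_on)
    \<comment> \<open>Row \<open>j\<close> sums to \<open>g j\<close> times the total of
      \<open>h\<close>, and these row totals are summable because \<open>g\<close> is.\<close>
    then have "(\<lambda>(j, m). g j * h m) summable_on UNIV \<times> UNIV"
      using g(2) h(2) by (intro summable_on_SigmaI[where g = "\<lambda>j. g j * (\<Sum>\<^sub>\<infinity>m. h m)"]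
          summable_on_cmult_left) (auto intro: has_sum_cmult_right has_sum_infsum)
    then have "(\<lambda>p. (case p of (j, m) \<Rightarrow> g j * h m) * K) summable_on UNIV"
      by (intro summable_on_cmult_left) simp
    then have "(\<lambda>p. norm (case p of (j, m) \<Rightarrow> \<phi> b (a j m))) summable_on UNIV"
    proof (rule Infinite_Sum.abs_summable_on_comparison_test')
      fix p :: "nat \<times> nat"
      obtain j m where p: "p = (j, m)"
        by force
      show "norm (case p of (j, m) \<Rightarrow> \<phi> b (a j m)) \<le> (case p of (j, m) \<Rightarrow> g j * h m) * K"
        using K(1)[of "a j m"] mult_right_mono[OF bound[of j m] K(2)] by (simp add: p)
    qed
    then have "(\<lambda>(j, m). norm (\<phi> b (a j m))) summable_on UNIV"
      by (simp add: case_prod_unfold)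
    moreover have "(\<lambda>n. \<Sum>j\<le>n. \<phi> b (a j (n - j))) sums \<phi> b L"
      using sums[OF diag] by (simp add: sum)
    ultimately have "(\<lambda>j. \<Sum>m. \<phi> b (a j m)) sums \<phi> b L"
      by (rule abs_summable_diagonal_sums)
    then show ?thesis
      by (simp add: suminf summ)
  qed
  then have "(\<lambda>j. \<Sum>b\<in>B. \<phi> b (\<Sum>m. a j m) *\<^sub>R b) sums (\<Sum>b\<in>B. \<phi> b L *\<^sub>R b)"
    by (intro sums_sum sums_scaleR_left)
  then show "(\<lambda>j. \<Sum>m. a j m) sums L"
    by (simp flip: repr)
qed

section \<open>Powers and exponentials of linear operators\<close>

lemma norm_funpow_le:
  fixes f :: "'a::real_normed_vector \<Rightarrow> 'a"
  assumes "\<And>x. norm (f x) \<le> K * norm x" and "K \<ge> 0"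
  shows "norm ((f ^^ n) x) \<le> K ^ n * norm x"
proof (induction n)
  case (Suc n)
  have "norm ((f ^^ Suc n) x) \<le> K * norm ((f ^^ n) x)"
    using assms(1) by simp
  also have "\<dots> \<le> K * (K ^ n * norm x)"
    using Suc assms(2) by (rule mult_left_mono)
  finally show ?case
    by (simp add: mult.assoc)
qed simp

lemma linear_funpow:
  fixes f :: "'a::real_vector \<Rightarrow> 'a"
  assumes "linear f"
  shows "linear (f ^^ n)"
proof (induction n)
  case 0
  then show ?case
    using linear_id by (simp add: id_def)
next
  case (Suc n)
  then show ?case
    using linear_compose[OF _ assms] by (simp add: o_def)
qed

lemma sum_funpow_telescope:
  fixes f g :: "'a::real_vector \<Rightarrow> 'a"
  assumes "linear f"
  shows "(\<Sum>j\<le>n. (f ^^ j) (f ((g ^^ (n - j)) x) - g ((g ^^ (n - j)) x)))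
    = (f ^^ Suc n) x - (g ^^ Suc n) x"
proof -
  \<comment> \<open>Writing \<open>n - j\<close> as \<open>Suc n - Suc j\<close> shows each summand
    as a difference of consecutive values of \<open>(f ^^ j) ((g ^^ (Suc n - j)) x)\<close>.\<close>
  have "(\<Sum>j\<le>n. (f ^^ j) (f ((g ^^ (n - j)) x) - g ((g ^^ (n - j)) x)))
      = (\<Sum>j\<le>n. (f ^^ Suc j) ((g ^^ (Suc n - Suc j)) x) - (f ^^ j) ((g ^^ (Suc n - j)) x))"
    by (intro sum.cong)
      (auto simp: linear_diff[OF linear_funpow[OF assms]] funpow_swap1 Suc_diff_le)
  also have "\<dots> = (f ^^ Suc n) x - (g ^^ Suc n) x"
    using sum_lessThan_telescope[of "\<lambda>j. (f ^^ j) ((g ^^ (Suc n - j)) x)" "Suc n"]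
    by (simp add: lessThan_Suc_atMost)
  finally show ?thesis .
qed

text \<open>Used to replace \<open>1 / fact (j + m + 1)\<close> by
  \<open>1 / (fact j * fact m)\<close>, which bounds the double series by a product of two
  exponential series.\<close>

lemma fact_mult_fact_le: "fact j * fact m \<le> (fact (j + m + 1) :: real)"
proof -
  have "fact j * fact m \<le> (fact (j + m) :: nat)"
    by (intro dvd_imp_le fact_fact_dvd_fact) simp
  also have "\<dots> \<le> fact (j + m + 1)"
    by (intro fact_mono_nat) simp
  finally show ?thesis
    by (metis of_nat_fact of_nat_le_iff of_nat_mult)
qed

text \<open>\<open>exp_op\<close> is a bare \<open>suminf\<close>; convergence comes from the real
  exponential series at an operator bound \<open>K\<close> of \<open>f\<close>.\<close>

lemma sums_exp_op:
  fixes f :: "'a::real_normed_vector \<Rightarrow> 'a"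
  assumes S: "finite S" "span S = (UNIV :: 'a set)" and "linear f"
  shows "(\<lambda>n. (1 / fact n) *\<^sub>R (f ^^ n) x) sums exp_op f x"
proof -
  interpret bounded_linear f
    using S assms(3) by (rule finite_span_linear_imp_bounded_linear)
  obtain K where K: "\<And>x. norm (f x) \<le> K * norm x" "K \<ge> 0"
    using nonneg_bounded by (metis mult.commute)
  have "summable (\<lambda>n. K ^ n / fact n * norm x)"
    using summable_exp[of K] by (intro summable_mult2) (simp add: divide_inverse mult.commute)
  then have "summable (\<lambda>n. (1 / fact n) *\<^sub>R (f ^^ n) x)"
    by (rule finite_span_summable_comparison[OF S])
      (use norm_funpow_le[OF K] in \<open>simp add: divide_right_mono\<close>)
  then show ?thesis
    by (simp add: exp_op_def summable_sums)
qed

text \<open>The analytic core, for two arbitrary linear operators; the theorem takes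
  \<open>f\<close> to be \<open>ad (s X)\<close> and \<open>g\<close> to be its compression to the
  image of the section.\<close>

lemma exp_op_diff:
  fixes f g :: "'a::real_normed_vector \<Rightarrow> 'a"
  assumes S: "finite S" "span S = (UNIV :: 'a set)" and lin: "linear f" "linear g"
  defines "a \<equiv> \<lambda>j m x. (1 / fact (j + m + 1)) *\<^sub>R (f ^^ j) (f ((g ^^ m) x) - g ((g ^^ m) x))"
  shows "summable (\<lambda>m. a j m x)" and "(\<lambda>j. \<Sum>m. a j m x) sums (exp_op f x - exp_op g x)"
proof -
  obtain K where K: "\<And>x. norm (f x) \<le> K * norm x" "K \<ge> 0"
    using bounded_linear.nonneg_bounded[OF finite_span_linear_imp_bounded_linear[OF S lin(1)]]
    by (metis mult.commute)
  obtain M where M: "\<And>x. norm (g x) \<le> M * norm x" "M \<ge> 0"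
    using bounded_linear.nonneg_bounded[OF finite_span_linear_imp_bounded_linear[OF S lin(2)]]
    by (metis mult.commute)
  define u where "u j = K ^ j / fact j" for j
  \<comment> \<open>The factor \<open>K + M\<close> bounds the operator \<open>f - g\<close> applied
    to \<open>(g ^^ m) x\<close>.\<close>
  define v where "v m = M ^ m / fact m * ((K + M) * norm x)" for m
  have u: "summable u" "\<And>j. u j \<ge> 0"
    using summable_exp[of K] K(2) by (simp_all add: u_def[abs_def] divide_inverse mult.commute)
  have v: "summable v" "\<And>m. v m \<ge> 0"
    using summable_mult2[OF summable_exp[of M]] K(2) M(2)
    by (simp_all add: v_def[abs_def] divide_inverse mult.commute)
  have bound: "norm (a j m x) \<le> u j * v m" for j m
  proof -
    let ?w = "(g ^^ m) x"
    have "norm (f ?w - g ?w) \<le> norm (f ?w) + norm (g ?w)"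
      by (rule norm_triangle_ineq4)
    also have "\<dots> \<le> (K + M) * norm ?w"
      using K(1)[of ?w] M(1)[of ?w] by (simp add: distrib_right)
    also have "\<dots> \<le> (K + M) * (M ^ m * norm x)"
      using norm_funpow_le[OF M] K(2) M(2) by (intro mult_left_mono) auto
    finally have "norm ((f ^^ j) (f ?w - g ?w)) \<le> K ^ j * ((K + M) * (M ^ m * norm x))"
      using norm_funpow_le[OF K, of j "f ?w - g ?w"] K(2)
      by (meson mult_left_mono order_trans zero_le_power)
    then have "norm (a j m x) \<le> K ^ j * ((K + M) * (M ^ m * norm x)) / fact (j + m + 1)"
      unfolding a_def by (simp add: divide_right_mono del: fact_Suc)
    also have "\<dots> \<le> K ^ j * ((K + M) * (M ^ m * norm x)) / (fact j * fact m)"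
      using fact_mult_fact_le[of j m] K(2) M(2) by (intro divide_left_mono) auto
    finally show ?thesis
      by (simp add: u_def v_def mult_ac)
  qed
  \<comment> \<open>The zeroth terms of both exponentials equal \<open>x\<close> and cancel;
    dropping them shifts the index to \<open>Suc n\<close>, matching the telescoped
    diagonals.\<close>
  have "(\<lambda>n. (1 / fact (Suc n)) *\<^sub>R (f ^^ Suc n) x - (1 / fact (Suc n)) *\<^sub>R (g ^^ Suc n) x) sums
      (exp_op f x - (1 / fact 0) *\<^sub>R (f ^^ 0) x - (exp_op g x - (1 / fact 0) *\<^sub>R (g ^^ 0) x))"
    using sums_exp_op[OF S lin(1)] sums_exp_op[OF S lin(2)]
    by (intro sums_diff) (subst sums_Suc_iff, simp)+
  also have "(\<lambda>n. (1 / fact (Suc n)) *\<^sub>R (f ^^ Suc n) x - (1 / fact (Suc n)) *\<^sub>R (g ^^ Suc n) x)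
      = (\<lambda>n. \<Sum>j\<le>n. a j (n - j) x)"
    unfolding a_def scaleR_diff_right[symmetric] sum_funpow_telescope[OF lin(1), symmetric]
    by (simp add: scaleR_sum_right)
  finally have diag: "(\<lambda>n. \<Sum>j\<le>n. a j (n - j) x) sums (exp_op f x - exp_op g x)"
    by simp
  show "summable (\<lambda>m. a j m x)" "(\<lambda>j. \<Sum>m. a j m x) sums (exp_op f x - exp_op g x)"
    by (rule finite_span_diagonal_sums[OF S u v bound diag])+
qed

section \<open>The quotient by the left center, its section and the rack cocycle\<close>

lemma obtain_finite_spanning_set:
  obtains S :: "'a::fd_leibniz_algebra set" where "finite S" and "span S = UNIV"
proof -
  obtain S :: "'a set" where S: "finite S" "\<And>x. \<exists>c. x = (\<Sum>b\<in>S. c b *\<^sub>R b)"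
    using finite_dim by blast
  then have "span S = UNIV"
    by (auto simp: span_finite)
  with S(1) show ?thesis
    by (rule that)
qed

lemma linear_ad: "linear (ad x)"
  by (rule linearI) (simp_all add: ad_def bracket_add_right bracket_scaleR_right)

lemma linear_proj: "linear proj"
  by (rule linearI; transfer) (simp_all add: subspace_0 subspace_left_center)

lemma proj_bracket: "proj (bracket x y) = bracket (proj x) (proj y)"
  by transfer (simp add: subspace_0 subspace_left_center)

lemma sums_proj:
  assumes "f sums x"
  shows "(\<lambda>n. proj (f n)) sums proj x"
proof -
  have "continuous_on UNIV proj"
    by (simp add: continuous_on_open_vimage open_h_Lie_def)
  from continuous_on_tendsto_compose[OF this assms[unfolded sums_def]] show ?thesis
    by (simp add: sums_def linear_sum[OF linear_proj])
qed

text \<open>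
  A linear section of the projection is continuous and injective, so it also transports
  uniqueness of limits to the quotient, where no separation axiom has been established.
\<close>

lemma sums_section:
  fixes s :: "'a::fd_leibniz_algebra h_Lie \<Rightarrow> 'a"
  assumes "linear s" and "f sums x"
  shows "(\<lambda>n. s (f n)) sums s x"
proof -
  obtain S :: "'a set" where S: "finite S" "span S = UNIV"
    by (rule obtain_finite_spanning_set)
  \<comment> \<open>By the quotient topology, \<open>s\<close> is continuous once
    \<open>s \<circ> proj\<close> is, and the latter is an endomorphism of the normed
    algebra.\<close>
  have "bounded_linear (s \<circ> proj)"
    using S linear_compose[OF linear_proj assms(1)] by (rule finite_span_linear_imp_bounded_linear)
  then have "open ((s \<circ> proj) -` U)" if "open U" for U
    using that by (intro open_vimage linear_continuous_on)
  then have "open (s -` U)" if "open U" for U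
    using that by (simp add: open_h_Lie_def vimage_comp)
  then have "continuous_on UNIV s"
    by (simp add: continuous_on_open_vimage)
  from continuous_on_tendsto_compose[OF this assms(2)[unfolded sums_def]] show ?thesis
    by (simp add: sums_def linear_sum[OF assms(1)])
qed

text \<open>\<open>suminf\<close> is a definite description, so existence and uniqueness of the sum
  in the quotient are both required. \<open>proj\<close> carries the sum down; any two sums have the
  same image under \<open>s\<close>, and \<open>proj\<close> recovers them from it.\<close>

lemma section_suminf:
  fixes s :: "'a::fd_leibniz_algebra h_Lie \<Rightarrow> 'a"
  assumes s: "linear s" "\<And>Z. proj (s Z) = Z"
    and f: "(\<lambda>n. s (f n)) sums x"
  shows "s (suminf f) = x"
proof -
  have "f sums proj x"
    using sums_proj[OF f] by (simp add: s(2))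
  moreover have "y = proj x" if "f sums y" for y
    using sums_unique2[OF sums_section[OF s(1) that] f] s(2) by metis
  ultimately have "suminf f = proj x" and "f sums proj x"
    unfolding suminf_def by blast+
  then show ?thesis
    using sums_unique2[OF sums_section[OF s(1)] f] by metis
qed

theorem lemma3p10:
  fixes s :: "'h::fd_leibniz_algebra h_Lie \<Rightarrow> 'h"
    and X Y :: "'h h_Lie"
  assumes "linear s"
    and "\<And>Z. proj (s Z) = Z"
  shows "(\<forall>j. summable (\<lambda>m. (1 / fact (j + m + 1)) *\<^sub>R
            (ad (s X) ^^ j) (omega s X ((ad X ^^ m) Y)))) \<and>
         (\<lambda>j. \<Sum>m. (1 / fact (j + m + 1)) *\<^sub>R
            (ad (s X) ^^ j) (omega s X ((ad X ^^ m) Y))) sums rack_cocycle s X Y"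
proof -
  \<comment> \<open>This \<open>B\<close> imitates \<open>ad X\<close> on the image of
    \<open>s\<close>, because \<open>proj\<close> respects brackets and
    \<open>proj (s X) = X\<close>. Both exponentials then live in the normed algebra.\<close>
  define B where "B = s \<circ> proj \<circ> ad (s X)"
  obtain S :: "'h set" where S: "finite S" "span S = UNIV"
    by (rule obtain_finite_spanning_set)
  have lin: "linear B"
    unfolding B_def by (intro linear_compose linear_ad linear_proj assms(1))
  have step: "s (ad X Z) = B (s Z)" for Z
    by (simp add: B_def ad_def proj_bracket assms(2))
  have pow: "s ((ad X ^^ m) Y) = (B ^^ m) (s Y)" for m
    by (induction m) (simp_all add: step)
  have om: "omega s X ((ad X ^^ m) Y) = ad (s X) ((B ^^ m) (s Y)) - B ((B ^^ m) (s Y))" for m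
    using step by (simp add: omega_def ad_def flip: pow)
  \<comment> \<open>The quotient carries only a topology, so its exponential is evaluated through
    its image under \<open>s\<close>.\<close>
  have "(\<lambda>n. s ((1 / fact n) *\<^sub>R (ad X ^^ n) Y)) sums exp_op B (s Y)"
    using sums_exp_op[OF S lin, of "s Y"] by (simp add: linear_scale[OF assms(1)] pow)
  then have "s (exp_op (ad X) Y) = exp_op B (s Y)"
    unfolding exp_op_def[of "ad X"] by (rule section_suminf[OF assms])
  then have "rack_cocycle s X Y = exp_op (ad (s X)) (s Y) - exp_op B (s Y)"
    by (simp add: rack_cocycle_def)
  then show ?thesis
    unfolding om using exp_op_diff[OF S linear_ad lin] by simp
qed

end
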